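(* Let $A\in(1,2]$ and $0\le\beta\le1$. If $f\in\tilde{\mathcal{S}}^*(\beta)$, then $\operatorname{Re}\left(T_f(z)\right)>0$ for $|z|<R_{\beta,\mathrm{Co}(A)}$, where $R_{\beta,\mathrm{Co}(A)}$ is the least value of $r\in(0,1)$ satisfying $\Phi_3(r)=0$ with $$\Phi_3(r)=(A+1)\frac{1-r}{1+r}-\frac{4r\beta}{1-r^2}-2\left(\frac{1+r}{1-r}\right)^{\beta}.$$ The radius $R_{\beta,\mathrm{Co}(A)}$ is sharp, i.e. for no $R'\in(R_{\beta,\mathrm{Co}(A)},1]$ is it true that every $f\in\tilde{\mathcal{S}}^*(\beta)$ satisfies $\operatorname{Re}\left(T_f(z)\right)>0$ for all $|z|<R'$.
   Context: $\mathbb{D}=\{z\in\mathbb{C}:|z|<1\}$. $\mathcal{A}$ is the class of functions $f$ analytic in $\mathbb{D}$ with $f(0)=0$ and $f'(0)=1$. For analytic functions $f,g$ on $\mathbb{D}$, $f\prec g$ ($f$ is subordinate to $g$) means that there is an analytic $\omega:\mathbb{D}\to\mathbb{C}$ with $\omega(0)=0$, $|\omega(z)|<1$ and $f(z)=g(\omega(z))$ for all $z\in\mathbb{D}$. For $0\le\beta\le1$, $\tilde{\mathcal{S}}^*(\beta)$ (strongly starlike functions of order $\beta$) is the class of $f\in\mathcal{A}$ with $\frac{zf'(z)}{f(z)}\prec\left(\frac{1+z}{1-z}\right)^{\beta}$ (principal branch). For $A\in(1,2]$ and $f\in\mathcal{A}$, $$T_f(z)=\frac{2}{A-1}\left(\frac{A+1}{2}\cdot\frac{1+z}{1-z}-1-z\frac{f''(z)}{f'(z)}\right).$$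 The radius of concavity (with respect to $\mathrm{Co}(A)$) of a class $\mathcal{F}\subset\mathcal{A}$ is the largest $R\in(0,1]$ such that every $f\in\mathcal{F}$ satisfies $\operatorname{Re}(T_f(z))>0$ for all $|z|<R$. *)

theory Defs
  imports "HOL-Complex_Analysis.Complex_Analysis"
begin

abbreviation unit_disc :: "complex set" where
  "unit_disc \<equiv> ball 0 1"

definition class_A :: "(complex \<Rightarrow> complex) set" where
  "class_A = {f. f holomorphic_on unit_disc \<and> f 0 = 0 \<and> deriv f 0 = 1}"

definition subordinate :: "(complex \<Rightarrow> complex) \<Rightarrow> (complex \<Rightarrow> complex) \<Rightarrow> bool" where
  "subordinate f g \<longleftrightarrow>
     f holomorphic_on unit_disc \<and> g holomorphic_on unit_disc \<and>
     (\<exists>\<omega>. \<omega> holomorphic_on unit_disc \<and> \<omega> 0 = 0 \<and>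
        (\<forall>z\<in>unit_disc. norm (\<omega> z) < 1 \<and> f z = g (\<omega> z)))"

text \<open>
  The quotient \<open>z f'(z) / f(z)\<close> for \<open>f\<close> in \<open>class_A\<close>, with its removable singularity at the
  origin filled in: there \<open>f(z) / z\<close> tends to \<open>f'(0) = 1\<close>, so the value is 1, whereas the bare
  HOL expression would give \<open>0 / 0 = 0\<close>.
\<close>
definition starlike_quotient :: "(complex \<Rightarrow> complex) \<Rightarrow> complex \<Rightarrow> complex" where
  "starlike_quotient f z = (if z = 0 then 1 else z * deriv f z / f z)"

text \<open>
  For the quotient to be analytic in the disc, \<open>f\<close> must have no zero there except the origin. This
  implicit requirement is made explicit, so that division by zero plays no role.
\<close>
definition strongly_starlike :: "real \<Rightarrow> (complex \<Rightarrow> complex) set" where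
  "strongly_starlike \<beta> =
     {f \<in> class_A. (\<forall>z\<in>unit_disc - {0}. f z \<noteq> 0) \<and>
        subordinate (starlike_quotient f) (\<lambda>z. ((1 + z) / (1 - z)) powr of_real \<beta>)}"

definition T :: "real \<Rightarrow> (complex \<Rightarrow> complex) \<Rightarrow> complex \<Rightarrow> complex" where
  "T A f z = 2 / (of_real A - 1) *
     ((of_real A + 1) / 2 * ((1 + z) / (1 - z)) - 1 - z * (deriv (deriv f) z / deriv f z))"

definition Phi3 :: "real \<Rightarrow> real \<Rightarrow> real \<Rightarrow> real" where
  "Phi3 A \<beta> r = (A + 1) * ((1 - r) / (1 + r)) - 4 * r * \<beta> / (1 - r\<^sup>2)
     - 2 * ((1 + r) / (1 - r)) powr \<beta>"

end

theory Submission
  imports Defs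
begin

text \<open>
  If \<open>z f' / f = p\<close> with \<open>p = ((1 + \<omega>) / (1 - \<omega>)) powr \<beta>\<close> and \<open>\<omega>\<close> a Schwarz function, then
  logarithmic differentiation gives \<open>1 + z f'' / f' = p + 2 \<beta> z \<omega>' / (1 - \<omega>\<^sup>2)\<close>. The Schwarz lemma
  bounds the first summand and the Schwarz-Pick inequality bounds the second one by
  \<open>2 \<beta> r / (1 - r\<^sup>2)\<close>, so \<open>Re (T A f z)\<close> is at least \<open>Phi3 A \<beta> r / (A - 1)\<close>, where \<open>r = |z|\<close>. All
  these bounds are attained simultaneously at \<open>z = -r\<close> for \<open>\<omega> z = -z\<close>. Finally, \<open>Phi3 A \<beta>\<close> is
  strictly decreasing on \<open>(0, 1)\<close>.
\<close>

section \<open>The Schwarz-Pick inequality\<close>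

lemma Moebius_function_has_field_derivative:
  assumes "1 - cnj w * u \<noteq> 0"
  shows "(Moebius_function 0 w has_field_derivative
           of_real (1 - (norm w)\<^sup>2) / (1 - cnj w * u)\<^sup>2) (at u)"
proof -
  \<comment> \<open>In the numerator of the quotient rule the terms in \<open>u\<close> cancel,
    which leaves \<open>1 - w * cnj w\<close>.\<close>
  have eq: "1 * (1 - cnj w * u) - (u - w) * (- cnj w) = of_real (1 - (norm w)\<^sup>2)"
    by (simp only: of_real_diff complex_norm_square) (simp add: algebra_simps)
  have "((\<lambda>z. (z - w) / (1 - cnj w * z)) has_field_derivative
          (1 * (1 - cnj w * u) - (u - w) * (- cnj w)) / ((1 - cnj w * u) * (1 - cnj w * u))) (at u)"
    using assms by (auto intro!: derivative_eq_intros)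
  then show ?thesis
    unfolding eq Moebius_function_simple [abs_def] power2_eq_square .
qed

text \<open>Composing \<open>\<omega>\<close> with disc automorphisms reduces the claim to the
  Schwarz lemma at the origin; the chain rule turns its derivative bound into the bound at
  \<open>z\<close>.\<close>

lemma Schwarz_Pick_deriv:
  assumes hol: "\<omega> holomorphic_on ball 0 1"
    and lt: "\<And>z. norm z < 1 \<Longrightarrow> norm (\<omega> z) < 1" and z: "norm z < 1"
  shows "norm (deriv \<omega> z) \<le> (1 - (norm (\<omega> z))\<^sup>2) / (1 - (norm z)\<^sup>2)"
proof -
  define w where "w = \<omega> z"
  \<comment> \<open>The inner automorphism sends 0 to \<open>z\<close> and the outer one sends
    \<open>w\<close> to 0, so \<open>\<phi>\<close> fixes the origin.\<close>
  define \<phi> where "\<phi> = Moebius_function 0 w \<circ> \<omega> \<circ> Moebius_function 0 (- z)"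
  have w: "norm w < 1"
    using lt z by (simp add: w_def)
  have pos: "0 < 1 - (norm w)\<^sup>2" "0 < 1 - (norm z)\<^sup>2"
    using w z by (simp_all add: abs_square_less_1)
  have Mz: "Moebius_function 0 (- z) 0 = z"
    by (simp add: Moebius_function_simple)
  have "(Moebius_function 0 (- z) has_field_derivative of_real (1 - (norm z)\<^sup>2)) (at 0)"
    using Moebius_function_has_field_derivative [of "- z" 0] by simp
  moreover have "(\<omega> has_field_derivative deriv \<omega> z) (at (Moebius_function 0 (- z) 0))"
    using hol z by (auto intro: holomorphic_derivI simp: Mz)
  ultimately have d1: "(\<omega> \<circ> Moebius_function 0 (- z) has_field_derivative
      deriv \<omega> z * of_real (1 - (norm z)\<^sup>2)) (at 0)"
    by (rule DERIV_chain [rotated])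
  have eqw: "1 - cnj w * w = of_real (1 - (norm w)\<^sup>2)"
    by (simp only: of_real_diff complex_norm_square) (simp add: mult.commute)
  then have ne: "1 - cnj w * w \<noteq> 0"
    using pos(1) by (metis less_irrefl of_real_eq_0_iff)
  have "(Moebius_function 0 w has_field_derivative 1 / of_real (1 - (norm w)\<^sup>2)) (at w)"
    using Moebius_function_has_field_derivative [OF ne] pos
    unfolding eqw by (simp add: power2_eq_square del: of_real_diff of_real_power)
  then have "(\<phi> has_field_derivative
      1 / of_real (1 - (norm w)\<^sup>2) * (deriv \<omega> z * of_real (1 - (norm z)\<^sup>2))) (at 0)"
    unfolding \<phi>_def comp_assoc by (intro DERIV_chain d1) (simp add: Mz w_def)
  then have der: "deriv \<phi> 0 = 1 / of_real (1 - (norm w)\<^sup>2) * (deriv \<omega> z * of_real (1 - (norm z)\<^sup>2))"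
    by (rule DERIV_imp_deriv)
  have "norm (deriv \<phi> 0) \<le> 1"
  proof (rule Schwarz_Lemma(2))
    have "Moebius_function 0 w holomorphic_on ball 0 1"
      "Moebius_function 0 (- z) holomorphic_on ball 0 1"
      using w z by (auto intro: Moebius_function_holomorphic)
    moreover have "Moebius_function 0 (- z) ` ball 0 1 \<subseteq> ball 0 1"
      using z by (simp add: image_subset_iff Moebius_function_norm_lt_1)
    moreover have "\<omega> ` ball 0 1 \<subseteq> ball 0 1"
      using lt by (simp add: image_subset_iff)
    ultimately show "\<phi> holomorphic_on ball 0 1"
      unfolding \<phi>_def
      by (metis (no_types) hol holomorphic_on_compose_gen comp_assoc)
    show "\<phi> 0 = 0"
      by (simp add: \<phi>_def Mz Moebius_function_eq_zero flip: w_def)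
    show "norm (\<phi> u) < 1" if "norm u < 1" for u
      using that w z lt by (simp add: \<phi>_def Moebius_function_norm_lt_1)
    \<comment> \<open>\<open>Schwarz_Lemma\<close> also asks for a point of the disc; the origin is
      supplied.\<close>
    show "norm (0::complex) < 1" by simp
  qed
  also have "norm (deriv \<phi> 0) = norm (deriv \<omega> z) * (1 - (norm z)\<^sup>2) / (1 - (norm w)\<^sup>2)"
    unfolding der norm_mult norm_divide norm_of_real using pos by simp
  finally show ?thesis
    using pos by (simp add: w_def field_simps)
qed

section \<open>The strongly starlike quotient\<close>

text \<open>The superordinate function of \<open>strongly_starlike\<close>: for
  \<open>0 < \<beta>\<close> and \<open>\<beta> \<le> 1\<close> it maps the disc onto the sector
  where the argument is below \<open>\<beta> * pi / 2\<close> in modulus.\<close>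

definition sector_map :: "real \<Rightarrow> complex \<Rightarrow> complex" where
  "sector_map \<beta> z = ((1 + z) / (1 - z)) powr of_real \<beta>"

text \<open>The Poisson kernel with pole 1. At \<open>z = 1\<close> both sides are 0 by the
  convention on division.\<close>

lemma Re_Cayley_eq: "Re ((1 + z) / (1 - z)) = (1 - (norm z)\<^sup>2) / (norm (1 - z))\<^sup>2"
  by (simp add: Re_divide cmod_power2) (simp add: power2_eq_square algebra_simps)

lemma Re_Cayley_pos:
  assumes "norm z < 1"
  shows "Re ((1 + z) / (1 - z)) > 0"
proof -
  have "1 - z \<noteq> 0"
    using assms by auto
  then show ?thesis
    unfolding Re_Cayley_eq using assms by (simp add: abs_square_less_1)
qed

text \<open>On a circle about the origin only the denominator of the Poisson kernel varies, and it
  is largest at \<open>z = - norm z\<close>.\<close>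

lemma Re_Cayley_ge:
  assumes "norm z < 1"
  shows "(1 - norm z) / (1 + norm z) \<le> Re ((1 + z) / (1 - z))"
proof -
  have "(norm (1 - z))\<^sup>2 \<le> (1 + norm z)\<^sup>2"
    using norm_triangle_ineq4 [of 1 z] by (intro power_mono) auto
  moreover have "0 < norm (1 - z)"
    using assms by auto
  ultimately have "(1 - (norm z)\<^sup>2) / (1 + norm z)\<^sup>2 \<le> Re ((1 + z) / (1 - z))"
    unfolding Re_Cayley_eq using assms
    by (intro divide_left_mono) (auto simp: abs_square_le_1 intro!: mult_pos_pos add_pos_nonneg)
  moreover have "(1 - (norm z)\<^sup>2) / (1 + norm z)\<^sup>2 = (1 - norm z) / (1 + norm z)"
  proof -
    have "1 + norm z \<noteq> 0"
      using norm_ge_zero [of z] by linarith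
    moreover have "1 - (norm z)\<^sup>2 = (1 - norm z) * (1 + norm z)"
      by (simp add: power2_eq_square algebra_simps)
    ultimately show ?thesis
      by (simp add: power2_eq_square)
  qed
  ultimately show ?thesis by simp
qed

lemma norm_Cayley_le:
  fixes w :: complex
  assumes "norm w \<le> r" "r < 1"
  shows "norm ((1 + w) / (1 - w)) \<le> (1 + r) / (1 - r)"
proof -
  have "norm (1 + w) \<le> 1 + r"
    using assms norm_triangle_ineq [of 1 w] by simp
  moreover have "1 - r \<le> norm (1 - w)"
    using assms norm_triangle_ineq2 [of 1 w] by simp
  ultimately show ?thesis
    unfolding norm_divide using assms norm_ge_zero [of w] by (intro frac_le) linarith+
qed

lemma sector_map_nonzero: "norm z < 1 \<Longrightarrow> sector_map \<beta> z \<noteq> 0"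
  using Re_Cayley_pos [of z] by (auto simp: sector_map_def)

text \<open>Written as value times logarithmic derivative, so that the value cancels later in
  \<open>starlike_quotient_log_deriv\<close>.\<close>

lemma sector_map_has_field_derivative:
  assumes "norm z < 1"
  shows "(sector_map \<beta> has_field_derivative sector_map \<beta> z * (2 * of_real \<beta> / (1 - z\<^sup>2))) (at z)"
proof -
  let ?q = "(1 + z) / (1 - z)"
  have q: "Re ?q > 0"
    using assms by (rule Re_Cayley_pos)
  have ne: "1 - z \<noteq> 0" "1 + z \<noteq> 0"
    using q by auto
  have "((\<lambda>u. (1 + u) / (1 - u)) has_field_derivative 2 / (1 - z)\<^sup>2) (at z)"
    using ne by (auto intro!: derivative_eq_intros simp: power2_eq_square field_simps)
  then have "(sector_map \<beta> has_field_derivative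
      of_real \<beta> * ?q powr (of_real \<beta> - 1) * (2 / (1 - z)\<^sup>2)) (at z)"
    \<comment> \<open>The base lies in the right half-plane, hence off the branch cut of the
      principal power.\<close>
    unfolding sector_map_def [abs_def]
    using q by (intro DERIV_chain2 [OF has_field_derivative_powr])
      (auto simp: complex_nonpos_Reals_iff)
  moreover have "of_real \<beta> * ?q powr (of_real \<beta> - 1) * (2 / (1 - z)\<^sup>2)
      = sector_map \<beta> z * (2 * of_real \<beta> / (1 - z\<^sup>2))"
  proof -
    have "?q powr (of_real \<beta> - 1) = sector_map \<beta> z / ?q"
      using ne by (simp add: sector_map_def powr_diff)
    moreover have "1 - z\<^sup>2 = (1 - z) * (1 + z)"
      by (simp add: power2_eq_square algebra_simps)
    ultimately show ?thesis
      using ne by (simp add: power2_eq_square mult_ac)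
  qed
  ultimately show ?thesis by simp
qed

lemma sector_map_holomorphic: "sector_map \<beta> holomorphic_on ball 0 1"
  unfolding holomorphic_on_open [OF open_ball]
  using sector_map_has_field_derivative by (metis mem_ball_0)

text \<open>For a real exponent the modulus of the power is the power of the modulus, which is
  monotone as \<open>\<beta>\<close> is nonnegative.\<close>

lemma norm_sector_map_le:
  assumes "norm w \<le> r" "r < 1" "0 \<le> \<beta>"
  shows "norm (sector_map \<beta> w) \<le> ((1 + r) / (1 - r)) powr \<beta>"
  unfolding sector_map_def using norm_Cayley_le [of w r] assms
  by (simp add: norm_powr_real_powr' powr_mono2)

text \<open>No logarithm is taken: the identity \<open>u * deriv f u = p u * f u\<close> is
  differentiated at \<open>z\<close> and divided by \<open>deriv f z\<close>.\<close>

lemma starlike_quotient_log_deriv: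
  assumes f: "f \<in> class_A" "\<And>z. z \<in> unit_disc - {0} \<Longrightarrow> f z \<noteq> 0"
    and \<omega>: "\<omega> holomorphic_on unit_disc" "\<And>z. z \<in> unit_disc \<Longrightarrow> norm (\<omega> z) < 1"
    and eq: "\<And>z. z \<in> unit_disc \<Longrightarrow> starlike_quotient f z = sector_map \<beta> (\<omega> z)"
    and z: "z \<in> unit_disc" "z \<noteq> 0"
  shows "1 + z * (deriv (deriv f) z / deriv f z)
    = sector_map \<beta> (\<omega> z) + 2 * of_real \<beta> * z * deriv \<omega> z / (1 - (\<omega> z)\<^sup>2)"
proof -
  define p where "p = sector_map \<beta> \<circ> \<omega>"
  define p' where "p' = p z * (2 * of_real \<beta> / (1 - (\<omega> z)\<^sup>2)) * deriv \<omega> z"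
  have hol: "f holomorphic_on unit_disc" and "f 0 = 0"
    using f(1) by (auto simp: class_A_def)
  have p: "p u \<noteq> 0" if "u \<in> unit_disc" for u
    using \<omega>(2) that by (simp add: p_def sector_map_nonzero)
  \<comment> \<open>Cleared of denominators, the identity also holds at the origin, hence on the
    whole open disc, and may be differentiated there.\<close>
  have feq: "u * deriv f u = p u * f u" if "u \<in> unit_disc" for u
  proof (cases "u = 0")
    case False
    then have "u * deriv f u / f u = p u" "f u \<noteq> 0"
      using eq [OF that] f(2) that by (auto simp: starlike_quotient_def p_def)
    then show ?thesis by (simp add: field_simps)
  qed (simp add: \<open>f 0 = 0\<close>)
  have "(p has_field_derivative p') (at z)"
    unfolding p_def p'_def comp_def
    by (rule DERIV_chain2 [OF sector_map_has_field_derivative holomorphic_derivI [OF \<omega>(1)]])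
      (use \<omega>(2) z in auto)
  moreover have "(f has_field_derivative deriv f z) (at z)"
    using hol z by (auto intro: holomorphic_derivI)
  ultimately have "((\<lambda>u. p u * f u) has_field_derivative p' * f z + deriv f z * p z) (at z)"
    by (rule DERIV_mult)
  then have "((\<lambda>u. u * deriv f u) has_field_derivative p' * f z + deriv f z * p z) (at z)"
    by (rule has_field_derivative_transform_within_open [of _ _ _ unit_disc])
      (use z feq in auto)
  moreover have "(deriv f has_field_derivative deriv (deriv f) z) (at z)"
    using holomorphic_deriv [OF hol] z by (auto intro: holomorphic_derivI)
  then have "((\<lambda>u. u * deriv f u) has_field_derivative
      1 * deriv f z + deriv (deriv f) z * z) (at z)"
    by (intro DERIV_mult DERIV_ident)
  ultimately have main: "deriv f z + deriv (deriv f) z * z = p' * f z + deriv f z * p z"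
    using DERIV_unique by fastforce
  have nz: "f z \<noteq> 0"
    using f(2) z by auto
  then have dnz: "deriv f z \<noteq> 0"
    using feq [OF z(1)] p [OF z(1)] by auto
  \<comment> \<open>This factor \<open>1 / p z\<close> cancels the factor \<open>p z\<close> in
    \<open>p'\<close>.\<close>
  have quot: "f z / deriv f z = z / p z"
    using feq [OF z(1)] dnz p [OF z(1)] by (simp add: field_simps)
  have "1 + z * (deriv (deriv f) z / deriv f z)
      = (deriv f z + deriv (deriv f) z * z) / deriv f z"
    using dnz by (simp add: field_simps)
  also have "\<dots> = p z + p' * (f z / deriv f z)"
    unfolding main using dnz by (simp add: field_simps)
  also have "p' * (f z / deriv f z) = 2 * of_real \<beta> * z * deriv \<omega> z / (1 - (\<omega> z)\<^sup>2)"
    unfolding quot using p [OF z(1)] by (simp add: p'_def)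
  finally show ?thesis
    by (simp add: p_def)
qed

section \<open>The lower bound\<close>

text \<open>Isolates the expression computed by \<open>starlike_quotient_log_deriv\<close>; the
  coefficients are real, so \<open>Re\<close> passes through them.\<close>

lemma Re_T_eq:
  "Re (T A f z) = 2 / (A - 1) * ((A + 1) / 2 * Re ((1 + z) / (1 - z))
     - Re (1 + z * (deriv (deriv f) z / deriv f z)))"
proof -
  have "T A f z = of_real (2 / (A - 1)) * (of_real ((A + 1) / 2) * ((1 + z) / (1 - z))
     - (1 + z * (deriv (deriv f) z / deriv f z)))"
    by (simp add: T_def algebra_simps)
  then show ?thesis
    by (simp only: scaleR_conv_of_real [symmetric] scaleR_complex.sel minus_complex.sel)
qed

text \<open>Puts \<open>Phi3\<close> in the shape of \<open>Re_T_eq\<close>, so that the two can be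
  compared term by term.\<close>

lemma Phi3_div:
  "Phi3 A \<beta> r / (A - 1) = 2 / (A - 1) * ((A + 1) / 2 * ((1 - r) / (1 + r))
     - (((1 + r) / (1 - r)) powr \<beta> + 2 * \<beta> * r / (1 - r\<^sup>2)))"
    (is "_ = 2 / (A - 1) * ?X")
proof -
  have "4 * r * \<beta> / (1 - r\<^sup>2) = 2 * (2 * \<beta> * r / (1 - r\<^sup>2))"
    by simp
  then have "Phi3 A \<beta> r = 2 * ?X"
    unfolding Phi3_def by algebra
  then show ?thesis by simp
qed

lemma Re_T_ge_Phi3:
  assumes A: "1 < A" and \<beta>: "0 \<le> \<beta>" and f: "f \<in> strongly_starlike \<beta>" and z: "norm z < 1"
  shows "Re (T A f z) \<ge> Phi3 A \<beta> (norm z) / (A - 1)"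
proof -
  define r where "r = norm z"
  obtain \<omega> where \<omega>: "\<omega> holomorphic_on unit_disc" "\<omega> 0 = 0"
      "\<And>z. z \<in> unit_disc \<Longrightarrow> norm (\<omega> z) < 1"
      "\<And>z. z \<in> unit_disc \<Longrightarrow> starlike_quotient f z = sector_map \<beta> (\<omega> z)"
    using f by (auto simp: strongly_starlike_def subordinate_def sector_map_def)
  have fA: "f \<in> class_A" "\<And>z. z \<in> unit_disc - {0} \<Longrightarrow> f z \<noteq> 0"
    using f by (auto simp: strongly_starlike_def)
  have r: "0 \<le> r" "r < 1" "r\<^sup>2 < 1"
    using z by (simp_all add: r_def abs_square_less_1)
  have "Re (1 + z * (deriv (deriv f) z / deriv f z))
      \<le> ((1 + r) / (1 - r)) powr \<beta> + 2 * \<beta> * r / (1 - r\<^sup>2)"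
  proof (cases "z = 0")
    \<comment> \<open>The formula for the logarithmic derivative excludes the origin, but there both
      sides are 1.\<close>
    case True
    then show ?thesis by (simp add: r_def)
  next
    case False
    let ?w = "\<omega> z"
    have wr: "norm ?w \<le> r"
      unfolding r_def using \<omega> z by (intro Schwarz_Lemma(1)) auto
    then have w1: "norm ?w < 1" "(norm ?w)\<^sup>2 < 1"
      using r by (simp_all add: abs_square_less_1)
    \<comment> \<open>This lower bound for the denominator is also the numerator in the Schwarz-Pick
      bound, so the two cancel and the estimate no longer depends on
      \<open>\<omega> z\<close>.\<close>
    have "1 - (norm ?w)\<^sup>2 \<le> norm (1 - ?w\<^sup>2)"
      using norm_triangle_ineq2 [of 1 "?w\<^sup>2"] by (simp add: norm_power)
    then have "norm (deriv \<omega> z) / norm (1 - ?w\<^sup>2)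
        \<le> ((1 - (norm ?w)\<^sup>2) / (1 - r\<^sup>2)) / (1 - (norm ?w)\<^sup>2)"
      using Schwarz_Pick_deriv [OF \<omega>(1) _ z] \<omega>(3) w1 r
      by (intro frac_le) (auto simp: r_def)
    also have "\<dots> = 1 / (1 - r\<^sup>2)"
      using w1 by simp
    finally have "2 * \<beta> * r * (norm (deriv \<omega> z) / norm (1 - ?w\<^sup>2)) \<le> 2 * \<beta> * r * (1 / (1 - r\<^sup>2))"
      using \<beta> r by (intro mult_left_mono) auto
    moreover have "norm (2 * of_real \<beta> * z * deriv \<omega> z / (1 - ?w\<^sup>2))
        = 2 * \<beta> * r * (norm (deriv \<omega> z) / norm (1 - ?w\<^sup>2))"
      using \<beta> by (simp add: norm_mult norm_divide r_def)
    ultimately have "norm (2 * of_real \<beta> * z * deriv \<omega> z / (1 - ?w\<^sup>2)) \<le> 2 * \<beta> * r / (1 - r\<^sup>2)"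
      by (simp add: mult_ac)
    moreover have "norm (sector_map \<beta> ?w) \<le> ((1 + r) / (1 - r)) powr \<beta>"
      using wr r \<beta> by (intro norm_sector_map_le)
    moreover have "1 + z * (deriv (deriv f) z / deriv f z)
        = sector_map \<beta> ?w + 2 * of_real \<beta> * z * deriv \<omega> z / (1 - ?w\<^sup>2)"
      using fA \<omega> z False by (intro starlike_quotient_log_deriv) auto
    ultimately show ?thesis
      by (smt (verit) complex_Re_le_cmod norm_triangle_ineq)
  qed
  moreover have "(A + 1) / 2 * ((1 - r) / (1 + r)) \<le> (A + 1) / 2 * Re ((1 + z) / (1 - z))"
    unfolding r_def using A z by (intro mult_left_mono Re_Cayley_ge) auto
  ultimately show ?thesis
    unfolding Re_T_eq Phi3_div r_def [symmetric] using A
    by (intro mult_left_mono divide_nonneg_pos) linarith+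
qed

section \<open>The extremal function\<close>

text \<open>Integrates the equation \<open>z f' / f = p\<close>: the solution is \<open>z\<close>
  times the exponential of a primitive of \<open>(p z - 1) / z\<close>.\<close>

lemma class_A_prescribed_quotient:
  assumes "p holomorphic_on unit_disc" "p 0 = 1"
  obtains f where "f \<in> class_A" "\<And>z. z \<in> unit_disc - {0} \<Longrightarrow> f z \<noteq> 0"
    "\<And>z. z \<in> unit_disc \<Longrightarrow> starlike_quotient f z = p z"
proof -
  \<comment> \<open>The singularity at the origin is removable because \<open>p 0 = 1\<close> is
    subtracted; the derivative of \<open>p\<close> fills it.\<close>
  define k where "k z = (if z = 0 then deriv p 0 else (p z - p 0) / (z - 0))" for z
  have "k holomorphic_on unit_disc"
    unfolding k_def using assms(1) by (intro pole_lemma_open) auto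
  then obtain h where "\<And>z. z \<in> unit_disc \<Longrightarrow> (h has_field_derivative k z) (at z within unit_disc)"
    using holomorphic_convex_primitive' [of unit_disc k] by auto
  then have h: "(h has_field_derivative k z) (at z)" if "z \<in> unit_disc" for z
    using that by (metis at_within_open open_ball)
  \<comment> \<open>Subtracting \<open>h 0\<close> normalises the derivative at the origin to
    1.\<close>
  define f where "f z = z * exp (h z - h 0)" for z
  have df: "(f has_field_derivative p z * exp (h z - h 0)) (at z)" if "z \<in> unit_disc" for z
  proof -
    have "p z = 1 + z * k z"
      using assms(2) by (simp add: k_def)
    then show ?thesis
      unfolding f_def by (auto intro!: derivative_eq_intros h that simp: algebra_simps)
  qed
  show ?thesis
  proof
    show "f \<in> class_A"
      using df [of 0] assms(2)
      unfolding class_A_def holomorphic_on_open [OF open_ball]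
      by (auto simp: f_def intro!: DERIV_imp_deriv exI df)
    show "f z \<noteq> 0" if "z \<in> unit_disc - {0}" for z
      using that by (simp add: f_def)
    show "starlike_quotient f z = p z" if "z \<in> unit_disc" for z
      using assms(2) DERIV_imp_deriv [OF df [OF that]]
      by (auto simp: starlike_quotient_def f_def)
  qed
qed

text \<open>A single \<open>f\<close>, with quotient \<open>sector_map \<beta> (- z)\<close>, serves
  all \<open>A\<close> and \<open>r\<close>. At \<open>z = - r\<close> the two minus signs in
  \<open>z * deriv uminus z\<close> cancel, so both summands are nonnegative reals when
  \<open>\<beta>\<close> is nonnegative.\<close>

lemma exists_extremal:
  obtains f where "f \<in> strongly_starlike \<beta>"
    "\<And>A r. 0 < r \<Longrightarrow> r < 1 \<Longrightarrow> Re (T A f (- of_real r)) = Phi3 A \<beta> r / (A - 1)"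
proof -
  have hol: "(\<lambda>z. sector_map \<beta> (- z)) holomorphic_on unit_disc"
    using holomorphic_on_compose_gen [OF _ sector_map_holomorphic, of uminus unit_disc \<beta>]
    by (simp add: o_def image_subset_iff holomorphic_on_minus)
  have one: "sector_map \<beta> (- 0) = 1"
    by (simp add: sector_map_def)
  obtain f where fA: "f \<in> class_A" "\<And>z. z \<in> unit_disc - {0} \<Longrightarrow> f z \<noteq> 0"
    and q: "\<And>z. z \<in> unit_disc \<Longrightarrow> starlike_quotient f z = sector_map \<beta> (- z)"
    using class_A_prescribed_quotient [OF hol one] by blast
  have "starlike_quotient f holomorphic_on unit_disc"
    using hol by (rule holomorphic_transform) (simp add: q)
  then have "subordinate (starlike_quotient f) (sector_map \<beta>)"
    unfolding subordinate_def using sector_map_holomorphic q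
    by (auto intro!: exI [of _ uminus] holomorphic_intros)
  then have f: "f \<in> strongly_starlike \<beta>"
    using fA by (auto simp: strongly_starlike_def sector_map_def [abs_def])
  show ?thesis
  proof (rule that [OF f])
    fix A r :: real
    assume r: "0 < r" "r < 1"
    let ?z = "- complex_of_real r"
    have "deriv uminus ?z = (- 1 :: complex)"
      by (auto intro!: DERIV_imp_deriv derivative_eq_intros)
    moreover have "1 + ?z * (deriv (deriv f) ?z / deriv f ?z)
        = sector_map \<beta> (- ?z) + 2 * of_real \<beta> * ?z * deriv uminus ?z / (1 - (- ?z)\<^sup>2)"
      using r by (intro starlike_quotient_log_deriv fA q) (auto intro: holomorphic_intros)
    moreover have "(1 + complex_of_real r) / (1 - complex_of_real r) = of_real ((1 + r) / (1 - r))"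
      by simp
    then have "sector_map \<beta> (of_real r) = of_real (((1 + r) / (1 - r)) powr \<beta>)"
      unfolding sector_map_def using r by (subst powr_of_real [symmetric]) auto
    ultimately have "1 + ?z * (deriv (deriv f) ?z / deriv f ?z)
        = of_real (((1 + r) / (1 - r)) powr \<beta> + 2 * \<beta> * r / (1 - r\<^sup>2))"
      by simp
    then have "Re (1 + ?z * (deriv (deriv f) ?z / deriv f ?z))
        = ((1 + r) / (1 - r)) powr \<beta> + 2 * \<beta> * r / (1 - r\<^sup>2)"
      by (metis Re_complex_of_real)
    moreover have "(1 + ?z) / (1 - ?z) = of_real ((1 - r) / (1 + r))"
      by simp
    then have "Re ((1 + ?z) / (1 - ?z)) = (1 - r) / (1 + r)"
      by (metis Re_complex_of_real)
    ultimately show "Re (T A f ?z) = Phi3 A \<beta> r / (A - 1)"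
      unfolding Re_T_eq Phi3_div by simp
  qed
qed

section \<open>The radius\<close>

text \<open>Strictness comes from the first term, since the other two are constant for
  \<open>\<beta> = 0\<close>. The case \<open>r = 0\<close> is included to cover the centre of the
  disc.\<close>

lemma Phi3_strict_decreasing:
  assumes "1 < A" "0 \<le> \<beta>" "0 \<le> r" "r < s" "s < 1"
  shows "Phi3 A \<beta> s < Phi3 A \<beta> r"
proof -
  have "(1 - s) / (1 + s) < (1 - r) / (1 + r)"
    using assms by (simp add: field_simps)
  then have "(A + 1) * ((1 - s) / (1 + s)) < (A + 1) * ((1 - r) / (1 + r))"
    using assms by (intro mult_strict_left_mono) auto
  moreover have "4 * r * \<beta> / (1 - r\<^sup>2) \<le> 4 * s * \<beta> / (1 - s\<^sup>2)"
    using assms by (intro frac_le mult_right_mono) (auto simp: abs_square_less_1 intro!: power_mono)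
  moreover have "((1 + r) / (1 - r)) powr \<beta> \<le> ((1 + s) / (1 - s)) powr \<beta>"
    using assms by (intro powr_mono2 frac_le) auto
  ultimately show ?thesis
    unfolding Phi3_def by linarith
qed

text \<open>Intermediate value theorem on \<open>{0..1/2}\<close>: the value at 0 is
  \<open>A - 1\<close>, and at \<open>1/2\<close>, where \<open>(1 + r) / (1 - r)\<close> is 3, it
  is at most \<open>1 - 2\<close>.\<close>

lemma Phi3_has_root:
  assumes A: "1 < A" "A \<le> 2" and \<beta>: "0 \<le> \<beta>"
  obtains R where "0 < R" "R < 1" "Phi3 A \<beta> R = 0"
proof -
  have "1 \<le> (3::real) powr \<beta>"
    using \<beta> by (intro ge_one_powr_ge_zero) auto
  moreover have "Phi3 A \<beta> (1 / 2) = (A + 1) / 3 - 8 * \<beta> / 3 - 2 * 3 powr \<beta>"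
    by (simp add: Phi3_def power2_eq_square)
  ultimately have half: "Phi3 A \<beta> (1 / 2) \<le> 0"
    using A \<beta> by argo
  have zero: "Phi3 A \<beta> 0 > 0"
    using A by (simp add: Phi3_def)
  have "1 - x\<^sup>2 \<noteq> 0" "1 + x \<noteq> 0" "1 - x \<noteq> 0" if "x \<in> {0..1/2}" for x :: real
    using that abs_square_less_1 [of x] by auto
  then have "continuous_on {0..1/2} (Phi3 A \<beta>)"
    unfolding Phi3_def by (intro continuous_intros) auto
  then obtain R where R: "0 \<le> R" "R \<le> 1 / 2" "Phi3 A \<beta> R = 0"
    using IVT2' [of "Phi3 A \<beta>" "1 / 2" 0 0] half zero by auto
  then have "R \<noteq> 0"
    using zero by auto
  with R show ?thesis
    by (intro that) auto
qed

theorem theorem4p1: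
  fixes A \<beta> :: real
  assumes "1 < A" and "A \<le> 2" and "0 \<le> \<beta>" and "\<beta> \<le> 1"
  shows "\<exists>R.
    (0 < R \<and> R < 1 \<and> Phi3 A \<beta> R = 0 \<and> (\<forall>r. 0 < r \<and> r < 1 \<and> Phi3 A \<beta> r = 0 \<longrightarrow> R \<le> r)) \<and>
    (\<forall>f\<in>strongly_starlike \<beta>. \<forall>z. norm z < R \<longrightarrow> Re (T A f z) > 0) \<and>
    (\<forall>R'. R < R' \<and> R' \<le> 1 \<longrightarrow>
       \<not> (\<forall>f\<in>strongly_starlike \<beta>. \<forall>z. norm z < R' \<longrightarrow> Re (T A f z) > 0))"
proof -
  obtain R where R: "0 < R" "R < 1" "Phi3 A \<beta> R = 0"
    using Phi3_has_root assms by metis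
  \<comment> \<open>A smaller root would contradict strict decrease, so any root is the least
    one.\<close>
  have "R \<le> r" if "0 < r" "r < 1" "Phi3 A \<beta> r = 0" for r
    using Phi3_strict_decreasing [of A \<beta> r R] that assms R by force
  moreover have "Re (T A f z) > 0" if "f \<in> strongly_starlike \<beta>" "norm z < R" for f z
  proof -
    have "0 < Phi3 A \<beta> (norm z) / (A - 1)"
      using Phi3_strict_decreasing [of A \<beta> "norm z" R] that assms R by simp
    also have "\<dots> \<le> Re (T A f z)"
      using that assms R by (intro Re_T_ge_Phi3) auto
    finally show ?thesis .
  qed
  \<comment> \<open>The extremal function makes the real part vanish at \<open>- R\<close>, a point
    inside every disc of radius larger than \<open>R\<close>.\<close>
  moreover obtain f where "f \<in> strongly_starlike \<beta>" "Re (T A f (- of_real R)) = 0"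
    using exists_extremal [of \<beta>] R by (metis div_0)
  then have "\<not> (\<forall>f\<in>strongly_starlike \<beta>. \<forall>z. norm z < R' \<longrightarrow> Re (T A f z) > 0)"
    if "R < R'" for R'
    using that R by (auto intro!: bexI [of _ f] exI [of _ "- of_real R"])
  ultimately show ?thesis
    using R by blast
qed

end
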